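(* Let $G$ be a virtually abelian group. For every finite monoid generating set $X$ of $G$ and every regular language $R\subseteq X^*$, the cogrowth series $C_R(z)$ is the diagonal of an $\mathbb{N}$-rational series; that is, there are an integer $p\geq 1$ and an $\mathbb{N}$-rational power series $r(x_1,\ldots,x_p)\in\mathbb{N}[[x_1,\ldots,x_p]]$ such that $C_R(z)=\mathrm{Diag}(r)(z)$.
   Context: $\mathbb{N}=\{0,1,2,\ldots\}$. A group is virtually abelian if it has an abelian subgroup of finite index. A finite monoid generating set $X$ of $G$ is a finite set of elements generating $G$ as a monoid; $X^*$ is the set of all words over $X$; for $w\in X^*$, $|w|_X$ is its length as a word and $\overline{w}\in G$ is the element it represents. A language $R\subseteq X^*$ is regular if it is accepted by a finite-state automaton. The cogrowth series of $G$ with respect to $R$ is $C_R(z)=\sum_{k=0}^\infty c_k z^k\in\mathbb{N}[[z]]$, where $c_k=\#\{w\in R\mid |w|_X=k \text{ and } \overline{w}=1\}$. The class of $\mathbb{N}$-rational series in variables $\mathbf{x}=(x_1,\ldots,x_p)$ is the smallest subset of $\mathbb{N}[[\mathbf{x}]]$ which contains the polynomials $\mathbb{N}[\mathbf{x}]$ and is closed under addition, multiplication and quasi-inverse, where closure under quasi-inverse means that if $h(\mathbf{x})$ is in the class and $h(0,\ldots,0)=0$, then $1/(1-h(\mathbf{x}))$ is in the class. The (complete) diagonal of $f(\mathbf{x})=\sum_{k_1,\ldots,k_p\in\mathbb{N}}a(k_1,\ldots,k_p)x_1^{k_1}\cdots x_p^{k_p}$ is the univariate power series $\mathrm{Diag}(f)(z)=\sum_{k\in\mathbb{N}}a(k,k,\ldots,k)z^k$.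 *)

theory Defs
  imports
    "HOL-Algebra.Coset"
    "HOL-Library.Poly_Mapping"
    "HOL-Computational_Algebra.Formal_Power_Series"
begin

section \<open>Groups, words and languages\<close>

definition virtually_abelian :: "('a, 'b) monoid_scheme \<Rightarrow> bool" where
  "virtually_abelian G \<longleftrightarrow>
     (\<exists>H. subgroup H G \<and> comm_group (G\<lparr>carrier := H\<rparr>) \<and> finite (rcosets\<^bsub>G\<^esub> H))"

definition word_value :: "('a, 'b) monoid_scheme \<Rightarrow> 'a list \<Rightarrow> 'a" where
  "word_value G w = foldr (\<otimes>\<^bsub>G\<^esub>) w \<one>\<^bsub>G\<^esub>"

definition finite_monoid_generating_set :: "('a, 'b) monoid_scheme \<Rightarrow> 'a set \<Rightarrow> bool" where
  "finite_monoid_generating_set G X \<longleftrightarrow>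
     finite X \<and> X \<subseteq> carrier G \<and> (\<forall>g\<in>carrier G. \<exists>w\<in>lists X. word_value G w = g)"

text \<open>
  Acceptance by a complete deterministic finite automaton over the alphabet \<open>X\<close>, with transition
  function \<open>\<delta>\<close>, initial state \<open>q0\<close> and accepting states \<open>F\<close>. A finite state set can always be
  relabelled by natural numbers, so the choice of the type of states is immaterial.
\<close>

definition regular_language :: "'a set \<Rightarrow> 'a list set \<Rightarrow> bool" where
  "regular_language X R \<longleftrightarrow>
     (\<exists>(Q :: nat set) q0 F \<delta>.
        finite Q \<and> q0 \<in> Q \<and> F \<subseteq> Q \<and> (\<forall>q\<in>Q. \<forall>x\<in>X. \<delta> q x \<in> Q) \<and>
        R = {w \<in> lists X. foldl \<delta> q0 w \<in> F})"

definition cogrowth_series :: "('a, 'b) monoid_scheme \<Rightarrow> 'a list set \<Rightarrow> nat fps" where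
  "cogrowth_series G R = Abs_fps (\<lambda>k. card {w \<in> R. length w = k \<and> word_value G w = \<one>\<^bsub>G\<^esub>})"


section \<open>Multivariate power series\<close>

text \<open>
  A power series is its coefficient function on monomials. The monomial
  \<open>x_0^(m 0) * x_1^(m 1) * \<dots>\<close> is represented by its finitely supported exponent vector \<open>m\<close>;
  the variables of a series in \<open>p\<close> variables are indexed by \<open>{..<p}\<close>.
\<close>

type_synonym 'a mps = "(nat \<Rightarrow>\<^sub>0 nat) \<Rightarrow> 'a"

definition mps_in_vars :: "nat \<Rightarrow> 'a::zero mps set" where
  "mps_in_vars p = {f. \<forall>m. f m \<noteq> 0 \<longrightarrow> Poly_Mapping.keys m \<subseteq> {..<p}}"

definition mps_polynomials :: "nat \<Rightarrow> 'a::zero mps set" where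
  "mps_polynomials p = {f \<in> mps_in_vars p. finite {m. f m \<noteq> 0}}"

definition mps_one :: "'a::zero_neq_one mps" where
  "mps_one m = (if m = 0 then 1 else 0)"

definition mps_add :: "'a::plus mps \<Rightarrow> 'a mps \<Rightarrow> 'a mps" where
  "mps_add f g m = f m + g m"

definition mps_mult :: "'a::semiring_0 mps \<Rightarrow> 'a mps \<Rightarrow> 'a mps" where
  "mps_mult f g m = (\<Sum>(a, b) | a + b = m. f a * g b)"

text \<open>
  \<open>is_quasi_inverse h s\<close> says that \<open>s = 1/(1 - h)\<close>, i.e. \<open>(1 - h) * s = 1\<close> as series with integer
  coefficients. For \<open>h\<close> without constant term there is exactly one such \<open>s\<close> with coefficients
  in the natural numbers; see \<open>quasi_inverse_ex1\<close> below.
\<close>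

definition is_quasi_inverse :: "nat mps \<Rightarrow> nat mps \<Rightarrow> bool" where
  "is_quasi_inverse h s \<longleftrightarrow>
     mps_mult (\<lambda>m. mps_one m - int (h m)) (\<lambda>m. int (s m)) = mps_one"

inductive_set nat_rational :: "nat \<Rightarrow> nat mps set" for p :: nat where
  poly: "f \<in> mps_polynomials p \<Longrightarrow> f \<in> nat_rational p"
| add: "f \<in> nat_rational p \<Longrightarrow> g \<in> nat_rational p \<Longrightarrow> mps_add f g \<in> nat_rational p"
| mult: "f \<in> nat_rational p \<Longrightarrow> g \<in> nat_rational p \<Longrightarrow> mps_mult f g \<in> nat_rational p"
| quasi_inverse: "h \<in> nat_rational p \<Longrightarrow> h 0 = 0 \<Longrightarrow> is_quasi_inverse h s \<Longrightarrow> s \<in> nat_rational p"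

definition mps_diagonal :: "nat \<Rightarrow> 'a mps \<Rightarrow> 'a fps" where
  "mps_diagonal p f = Abs_fps (\<lambda>k. f (\<Sum>i<p. Poly_Mapping.single i k))"


section \<open>Basic facts about multivariate power series\<close>

lemma finite_add_decompositions: "finite {(a, b). a + b = (m :: nat \<Rightarrow>\<^sub>0 nat)}"
proof -
  let ?D = "{(a, b). a + b = m}"
  let ?B = "{.. Max (insert 0 (Poly_Mapping.lookup m ` Poly_Mapping.keys m))}"
  let ?S = "{f. \<forall>x. (x \<in> Poly_Mapping.keys m \<longrightarrow> f x \<in> ?B) \<and> (x \<notin> Poly_Mapping.keys m \<longrightarrow> f x = (0::nat))}"
  have S: "finite ?S"
    by (rule finite_set_of_finite_funs) auto
  have in_S: "Poly_Mapping.lookup a \<in> ?S" if ab: "a + b = m" for a b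
  proof -
    have le: "Poly_Mapping.lookup a x \<le> Poly_Mapping.lookup m x" for x
      using ab by (auto simp: lookup_add)
    have "Poly_Mapping.lookup a x \<in> ?B" if "x \<in> Poly_Mapping.keys m" for x
    proof -
      have "Poly_Mapping.lookup m x \<le> Max (insert 0 (Poly_Mapping.lookup m ` Poly_Mapping.keys m))"
        using that by (intro Max_ge) auto
      with le[of x] show ?thesis
        by simp
    qed
    moreover have "Poly_Mapping.lookup a x = 0" if "x \<notin> Poly_Mapping.keys m" for x
      using le[of x] that by (simp add: in_keys_iff)
    ultimately show ?thesis
      by blast
  qed
  have "(\<lambda>(a, b). Poly_Mapping.lookup a) ` ?D \<subseteq> ?S"
    using in_S by force
  moreover have "inj_on (\<lambda>(a, b). Poly_Mapping.lookup a) ?D"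
    by (auto simp: inj_on_def lookup_inject)
  ultimately show ?thesis
    using S by (meson finite_imageD finite_subset)
qed

definition total_degree :: "(nat \<Rightarrow>\<^sub>0 nat) \<Rightarrow> nat" where
  "total_degree m = (\<Sum>i\<in>Poly_Mapping.keys m. Poly_Mapping.lookup m i)"

lemma total_degree_less:
  assumes "a + b = m" "a \<noteq> 0"
  shows "total_degree b < total_degree m"
proof -
  have eq: "total_degree k = Sum_any (Poly_Mapping.lookup k)" for k
    by (simp add: total_degree_def Sum_any.expand_set keys.rep_eq)
  have "total_degree m = total_degree a + total_degree b"
    using assms(1) unfolding eq by (auto simp: lookup_add Sum_any.distrib)
  moreover have "\<exists>i. Poly_Mapping.lookup a i \<noteq> 0"
    using assms(2) by (metis lookup_zero poly_mapping_eqI)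
  then have "total_degree a \<noteq> 0"
    by (auto simp: total_degree_def in_keys_iff)
  ultimately show ?thesis
    by simp
qed

lemma is_quasi_inverse_iff:
  "is_quasi_inverse h s \<longleftrightarrow> (\<forall>m. s m = mps_one m + mps_mult h s m)"
proof -
  have one: "(\<Sum>(a, b) | a + b = m. mps_one a * int (s b)) = int (s m)" for m
  proof -
    have "(\<Sum>(a, b) | a + b = m. mps_one a * int (s b)) = (\<Sum>(a, b)\<in>{(0, m)}. mps_one a * int (s b))"
      by (rule sum.mono_neutral_right)
        (auto simp: finite_add_decompositions mps_one_def split: if_splits)
    then show ?thesis
      by (simp add: mps_one_def)
  qed
  have "mps_mult (\<lambda>m. mps_one m - int (h m)) (\<lambda>m. int (s m)) m = int (s m) - int (mps_mult h s m)" for m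
  proof -
    have "mps_mult (\<lambda>m. mps_one m - int (h m)) (\<lambda>m. int (s m)) m =
        (\<Sum>(a, b) | a + b = m. mps_one a * int (s b)) - (\<Sum>(a, b) | a + b = m. int (h a * s b))"
      unfolding mps_mult_def sum_subtractf [symmetric]
      by (intro sum.cong) (auto simp: algebra_simps)
    then show ?thesis
      unfolding one by (simp add: mps_mult_def case_prod_unfold)
  qed
  moreover have "int (s m) - int (mps_mult h s m) = mps_one m \<longleftrightarrow> s m = mps_one m + mps_mult h s m" for m
    by (auto simp: mps_one_def)
  ultimately show ?thesis
    by (simp add: is_quasi_inverse_def fun_eq_iff)
qed

lemma quasi_inverse_ex1:
  assumes "h 0 = 0"
  shows "\<exists>!s. is_quasi_inverse h s"
proof -
  have mult: "mps_mult h s m = (\<Sum>(a, b) | a + b = m \<and> a \<noteq> 0. h a * s b)" for s m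
    unfolding mps_mult_def using assms
    by (intro sum.mono_neutral_right) (auto simp: finite_add_decompositions)
  define step where
    "step = (\<lambda>s m. mps_one m + (\<Sum>(a, b) | a + b = m \<and> a \<noteq> 0. h a * s b :: nat))"
  have qi: "is_quasi_inverse h s \<longleftrightarrow> (\<forall>m. s m = step s m)" for s
    by (simp add: is_quasi_inverse_iff mult step_def)
  have cong: "step s m = step t m"
    if eq: "\<And>b. total_degree b < total_degree m \<Longrightarrow> s b = t b" for s t m
  proof -
    have "s b = t b" if "a + b = m" "a \<noteq> 0" for a b
      using eq that total_degree_less by blast
    then have "(\<Sum>(a, b) | a + b = m \<and> a \<noteq> 0. h a * s b) = (\<Sum>(a, b) | a + b = m \<and> a \<noteq> 0. h a * t b)"
      by (intro sum.cong) auto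
    then show ?thesis
      by (simp add: step_def)
  qed
  define s where "s = wfrec (measure total_degree) step"
  have "s m = step s m" for m
  proof -
    have "s m = step (cut s (measure total_degree) m) m"
      unfolding s_def by (rule wfrec) simp
    also have "\<dots> = step s m"
      by (rule cong) (simp add: cut_apply)
    finally show ?thesis .
  qed
  then have "is_quasi_inverse h s"
    by (simp add: qi)
  moreover have "t = u" if tu: "is_quasi_inverse h t" "is_quasi_inverse h u" for t u
  proof
    fix m show "t m = u m"
    proof (induction m rule: measure_induct_rule[of total_degree])
      case (less m)
      then have "step t m = step u m"
        by (rule cong)
      moreover have "t m = step t m" "u m = step u m"
        using tu qi by blast+
      ultimately show ?case
        by simp
    qed
  qed
  ultimately show ?thesis
    by blast
qed

lemma mps_mult_nonzeroE:
  fixes f g :: "nat mps"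
  assumes "mps_mult f g m \<noteq> 0"
  obtains a b where "a + b = m" "f a \<noteq> 0" "g b \<noteq> 0"
proof -
  have "\<exists>x\<in>{(a, b). a + b = m}. (case x of (a, b) \<Rightarrow> f a * g b) \<noteq> 0"
    using assms unfolding mps_mult_def by (meson sum.neutral)
  then show thesis
    using that by auto
qed

lemma nat_rational_in_vars: "f \<in> nat_rational p \<Longrightarrow> f \<in> mps_in_vars p"
proof (induction rule: nat_rational.induct)
  case (poly f)
  then show ?case
    by (simp add: mps_polynomials_def)
next
  case (add f g)
  then show ?case
    by (auto simp: mps_in_vars_def mps_add_def)
next
  case (mult f g)
  have "Poly_Mapping.keys m \<subseteq> {..<p}" if m: "mps_mult f g m \<noteq> 0" for m
  proof -
    obtain a b where "a + b = m" "f a \<noteq> 0" "g b \<noteq> 0"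
      using m by (rule mps_mult_nonzeroE)
    then show ?thesis
      using mult.IH Poly_Mapping.keys_add[of a b] unfolding mps_in_vars_def by blast
  qed
  then show ?case
    by (simp add: mps_in_vars_def)
next
  case (quasi_inverse h s)
  have "s m \<noteq> 0 \<Longrightarrow> Poly_Mapping.keys m \<subseteq> {..<p}" for m
  proof (induction m rule: measure_induct_rule[of total_degree])
    case (less m)
    show ?case
    proof (cases "m = 0")
      case False
      then have "mps_mult h s m \<noteq> 0"
        using less.prems quasi_inverse.hyps by (simp add: is_quasi_inverse_iff mps_one_def)
      then obtain a b where ab: "a + b = m" "h a \<noteq> 0" "s b \<noteq> 0"
        by (rule mps_mult_nonzeroE)
      then have "a \<noteq> 0"
        using quasi_inverse.hyps by metis
      then have "Poly_Mapping.keys b \<subseteq> {..<p}"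
        using less.IH ab total_degree_less by blast
      then show ?thesis
        using ab quasi_inverse.IH Poly_Mapping.keys_add[of a b] unfolding mps_in_vars_def by blast
    qed simp
  qed
  then show ?case
    by (simp add: mps_in_vars_def)
qed

end

theory Submission
  imports Defs "HOL-Algebra.FiniteProduct"
begin

text \<open>
  Let \<open>H\<close> be an abelian subgroup of finite index. Reading a word letter by letter moves through the
  cosets of \<open>H\<close>, and with coset representatives every step (coset, letter) contributes an element
  of \<open>H\<close>. The word represents \<open>1\<close> iff it ends in the coset \<open>H\<close> and these contributions multiply to
  \<open>1\<close>. As \<open>H\<close> is abelian, the latter only depends on the vector \<open>n\<close> counting the steps, and
  says that \<open>n\<close> lies in a subgroup \<open>K\<close> of \<open>\<int>\<^sup>E\<close>. Among the solutions of a system of linear equations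
  \<open>A n = 0\<close> satisfied by \<open>K\<close>, membership in \<open>K\<close> only depends on \<open>n\<close> modulo some \<open>N\<close>, which a
  finite automaton can track.

  The equations are turned into a diagonal as follows. Take \<open>N\<close> so large that all \<open>A i e + N\<close> are
  nonnegative and put \<open>D i = (\<Sum>e. (A i e + N) * n e)\<close>. For a word of length \<open>k\<close>, the \<open>i\<close>-th equation
  says \<open>D i = N * k\<close>, i.e. \<open>D i\<close> is divisible by \<open>N\<close>, which the automaton sees, and
  \<open>D i div N = k\<close>. So mark the length by one variable and each \<open>D i div N\<close> by another: since
  its increments only depend on the state and the letter, the generating function solves a linear
  system with polynomial coefficients, and is \<open>\<nat>\<close>-rational.
\<close>

section \<open>The semiring of power series\<close>

lemma mps_mult_assoc:
  fixes f g h :: "'a::comm_semiring_0 mps"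
  shows "mps_mult (mps_mult f g) h = mps_mult f (mps_mult g h)"
proof
  fix m
  have "mps_mult (mps_mult f g) h m =
      (\<Sum>x\<in>{(u, c). u + c = m}. \<Sum>y\<in>{(a, b). a + b = fst x}. f (fst y) * g (snd y) * h (snd x))"
    unfolding mps_mult_def by (auto simp: sum_distrib_right case_prod_unfold intro!: sum.cong)
  also have "\<dots> = (\<Sum>(x, y)\<in>(SIGMA x:{(u, c). u + c = m}. {(a, b). a + b = fst x}).
      f (fst y) * g (snd y) * h (snd x))"
    by (rule sum.Sigma) (auto simp: finite_add_decompositions)
  also have "\<dots> = (\<Sum>(x, y)\<in>(SIGMA x:{(a, v). a + v = m}. {(b, c). b + c = snd x}).
      f (fst x) * (g (fst y) * h (snd y)))"
    by (rule sum.reindex_bij_witness[where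
          i = "\<lambda>((a, v), (b, c)). ((a + b, c), (a, b))" and
          j = "\<lambda>((u, c), (a, b)). ((a, b + c), (b, c))"])
      (auto simp: add.assoc mult.assoc)
  also have "\<dots> = (\<Sum>x\<in>{(a, v). a + v = m}. \<Sum>y\<in>{(b, c). b + c = snd x}.
      f (fst x) * (g (fst y) * h (snd y)))"
    by (rule sum.Sigma[symmetric]) (auto simp: finite_add_decompositions)
  also have "\<dots> = mps_mult f (mps_mult g h) m"
    unfolding mps_mult_def by (auto simp: sum_distrib_left case_prod_unfold intro!: sum.cong)
  finally show "mps_mult (mps_mult f g) h m = mps_mult f (mps_mult g h) m" .
qed

lemma mps_mult_add_right: "mps_mult f (mps_add g h) = mps_add (mps_mult f g) (mps_mult f h)"
  by (rule ext) (simp add: mps_mult_def mps_add_def distrib_left sum.distrib case_prod_unfold)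

lemma mps_mult_add_left: "mps_mult (mps_add f g) h = mps_add (mps_mult f h) (mps_mult g h)"
  by (rule ext) (simp add: mps_mult_def mps_add_def distrib_right sum.distrib case_prod_unfold)

lemma mps_mult_sum_right:
  "mps_mult f (\<lambda>m. \<Sum>j\<in>S. g j m) = (\<lambda>m. \<Sum>j\<in>S. mps_mult f (g j) m)"
  by (rule ext) (simp add: mps_mult_def sum_distrib_left case_prod_unfold, rule sum.swap)

lemma mps_mult_sum_left:
  "mps_mult (\<lambda>m. \<Sum>j\<in>S. f j m) g = (\<lambda>m. \<Sum>j\<in>S. mps_mult (f j) g m)"
  by (rule ext) (simp add: mps_mult_def sum_distrib_right case_prod_unfold, rule sum.swap)

text \<open>The sum has at most one term, because exponent vectors can be cancelled; this form
  avoids subtracting \<open>u\<close> from \<open>m\<close>.\<close>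

lemma mps_mult_monomial:
  fixes g :: "nat mps"
  shows "mps_mult (\<lambda>m. if m = u then 1 else 0) g m = (\<Sum>b | u + b = m. g b)"
proof -
  have "mps_mult (\<lambda>m. if m = u then 1 else 0) g m = (\<Sum>(a, b)\<in>{(a, b). a = u \<and> u + b = m}. g b)"
    unfolding mps_mult_def
    by (rule sum.mono_neutral_cong_right) (auto simp: finite_add_decompositions split: if_splits)
  also have "\<dots> = (\<Sum>b | u + b = m. g b)"
    by (rule sum.reindex_bij_witness[where i = "Pair u" and j = snd]) auto
  finally show ?thesis .
qed

lemma mps_mult_one_left:
  fixes g :: "nat mps"
  shows "mps_mult mps_one g = g"
proof
  fix m show "mps_mult mps_one g m = g m"
    using mps_mult_monomial[of 0 g m] by (simp add: mps_one_def[abs_def])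
qed

lemma mps_mult_0: "mps_mult f g 0 = f 0 * g 0"
proof -
  have "a + b = 0 \<longleftrightarrow> a = 0 \<and> b = 0" for a b :: "nat \<Rightarrow>\<^sub>0 nat"
    using total_degree_less[of a b 0] by (cases "a = 0") (auto simp: total_degree_def)
  then have "{(a, b). a + b = (0 :: nat \<Rightarrow>\<^sub>0 nat)} = {(0, 0)}"
    by simp
  then show ?thesis
    by (simp add: mps_mult_def)
qed

text \<open>As \<open>a\<close> has no constant term, a coefficient of \<open>mps_mult a f\<close>
  involves only coefficients of \<open>f\<close> of smaller total degree, so the equation determines
  \<open>f\<close> recursively.\<close>

lemma mps_affine_equation_unique:
  fixes a f g h :: "nat mps"
  assumes "a 0 = 0"
    and f: "f = mps_add g (mps_mult a f)" and h: "h = mps_add g (mps_mult a h)"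
  shows "f = h"
proof
  fix m show "f m = h m"
  proof (induction m rule: measure_induct_rule[of total_degree])
    case (less m)
    have "a u * f v = a u * h v" if "u + v = m" for u v
      using assms(1) less.IH[of v] total_degree_less[OF that] by (cases "u = 0") auto
    then have "mps_mult a f m = mps_mult a h m"
      unfolding mps_mult_def by (intro sum.cong) auto
    then show ?case
      using f h by (metis mps_add_def)
  qed
qed

text \<open>Arden's rule for power series: since \<open>s = 1 + a * s\<close>, the product
  \<open>s * g\<close> solves the same equation, and the solution is unique.\<close>

lemma mps_affine_equation_solution:
  assumes "a 0 = 0" "is_quasi_inverse a s" "f = mps_add g (mps_mult a f)"
  shows "f = mps_mult s g"
proof (rule mps_affine_equation_unique[OF assms(1,3)])
  have "s = mps_add mps_one (mps_mult a s)"
    using assms(2) by (auto simp: is_quasi_inverse_iff mps_add_def)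
  then show "mps_mult s g = mps_add g (mps_mult a (mps_mult s g))"
    by (metis mps_mult_add_left mps_mult_assoc mps_mult_one_left)
qed


section \<open>Rational series and linear systems\<close>

lemma nat_rational_zero: "(\<lambda>m. 0) \<in> nat_rational p"
  by (rule nat_rational.poly) (simp add: mps_polynomials_def mps_in_vars_def)

lemma nat_rational_monomial:
  assumes "Poly_Mapping.keys u \<subseteq> {..<p}"
  shows "(\<lambda>m. if m = u then 1 else 0) \<in> nat_rational p"
  using assms by (intro nat_rational.poly) (auto simp: mps_polynomials_def mps_in_vars_def)

lemma nat_rational_sum:
  assumes "\<And>i. i \<in> S \<Longrightarrow> f i \<in> nat_rational p"
  shows "(\<lambda>m. \<Sum>i\<in>S. f i m) \<in> nat_rational p"
  using assms
proof (induction S rule: infinite_finite_induct)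
  case (insert i S)
  then have "mps_add (f i) (\<lambda>m. \<Sum>i\<in>S. f i m) \<in> nat_rational p"
    by (intro nat_rational.add) auto
  then show ?case
    using insert by (simp add: mps_add_def[abs_def])
qed (auto simp: nat_rational_zero)

text \<open>Gaussian elimination: one unknown is solved for with a quasi-inverse and substituted.\<close>

lemma nat_rational_linear_system:
  assumes "finite S"
    and "\<And>i j. i \<in> S \<Longrightarrow> j \<in> S \<Longrightarrow> a i j \<in> nat_rational p"
    and "\<And>i j. i \<in> S \<Longrightarrow> j \<in> S \<Longrightarrow> a i j 0 = 0"
    and "\<And>i. i \<in> S \<Longrightarrow> c i \<in> nat_rational p"
    and "\<And>i. i \<in> S \<Longrightarrow> f i = mps_add (c i) (\<lambda>m. \<Sum>j\<in>S. mps_mult (a i j) (f j) m)"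
    and "i \<in> S"
  shows "f i \<in> nat_rational p"
  using assms
proof (induction S arbitrary: a c i rule: finite_induct)
  case (insert s T)
  note a = insert.prems(1) and a0 = insert.prems(2) and c = insert.prems(3) and eq = insert.prems(4)
  obtain t where t: "is_quasi_inverse (a s s) t"
    using quasi_inverse_ex1[of "a s s"] a0[of s s] by auto
  then have t_rat: "t \<in> nat_rational p"
    using a[of s s] a0[of s s] by (auto intro: nat_rational.quasi_inverse)
  \<comment> \<open>\<open>r\<close> collects the terms of the equation for \<open>f s\<close> other
    than the loop \<open>a s s\<close>.\<close>
  define r where "r = mps_add (c s) (\<lambda>m. \<Sum>j\<in>T. mps_mult (a s j) (f j) m)"
  have "f s = mps_add (c s) (\<lambda>m. \<Sum>j\<in>insert s T. mps_mult (a s j) (f j) m)"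
    by (rule eq) simp
  also have "\<dots> = mps_add r (mps_mult (a s s) (f s))"
    using insert.hyps by (simp add: r_def mps_add_def[abs_def] algebra_simps)
  finally have fs: "f s = mps_mult t r"
    using a0 by (intro mps_affine_equation_solution[OF _ t]) simp_all
  define b where "b i = mps_mult (a i s) t" for i
  have b: "b i \<in> nat_rational p" if "i \<in> T" for i
    unfolding b_def using that by (intro nat_rational.mult a t_rat) auto
  \<comment> \<open>Substituting \<open>f s = t * r\<close> turns the coefficient of
    \<open>f j\<close> into \<open>a i j + a i s * t * a s j\<close>, which still has constant term
    0.\<close>
  have T: "f i \<in> nat_rational p" if "i \<in> T" for i
  proof (rule insert.IH[where a = "\<lambda>i j. mps_add (a i j) (mps_mult (b i) (a s j))"
        and c = "\<lambda>i. mps_add (c i) (mps_mult (b i) (c s))"])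
    show "mps_add (a i j) (mps_mult (b i) (a s j)) \<in> nat_rational p" if "i \<in> T" "j \<in> T" for i j
      using that by (intro nat_rational.add nat_rational.mult a b) auto
    show "mps_add (a i j) (mps_mult (b i) (a s j)) 0 = 0" if "i \<in> T" "j \<in> T" for i j
      using that by (simp add: mps_add_def mps_mult_0 a0)
    show "mps_add (c i) (mps_mult (b i) (c s)) \<in> nat_rational p" if "i \<in> T" for i
      using that by (intro nat_rational.add nat_rational.mult b c) auto
    show "f i = mps_add (mps_add (c i) (mps_mult (b i) (c s)))
        (\<lambda>m. \<Sum>j\<in>T. mps_mult (mps_add (a i j) (mps_mult (b i) (a s j))) (f j) m)" if "i \<in> T" for i
    proof -
      have "mps_mult (a i s) (f s) = mps_mult (b i) r"
        by (simp add: fs b_def mps_mult_assoc)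
      also have "\<dots> = mps_add (mps_mult (b i) (c s))
          (\<lambda>m. \<Sum>j\<in>T. mps_mult (mps_mult (b i) (a s j)) (f j) m)"
        by (simp add: r_def mps_mult_add_right mps_mult_sum_right mps_mult_assoc)
      finally have subst: "mps_mult (a i s) (f s) = \<dots>" .
      have "f i = mps_add (c i) (\<lambda>m. \<Sum>j\<in>insert s T. mps_mult (a i j) (f j) m)"
        using that by (intro eq) simp
      also have "\<dots> = mps_add (mps_add (c i) (mps_mult (a i s) (f s)))
          (\<lambda>m. \<Sum>j\<in>T. mps_mult (a i j) (f j) m)"
        using insert.hyps by (simp add: mps_add_def[abs_def] add.assoc)
      finally show ?thesis
        unfolding subst by (simp add: mps_mult_add_left) (simp add: mps_add_def[abs_def] sum.distrib algebra_simps)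
    qed
    show "i \<in> T" by (rule that)
  qed
  moreover have "f s \<in> nat_rational p"
    unfolding fs r_def
    by (intro nat_rational.mult nat_rational.add nat_rational_sum t_rat a c T) auto
  ultimately show ?case
    using insert.prems(5) by blast
qed simp

section \<open>Words with finite state and counters\<close>

text \<open>
  Here \<open>\<kappa>\<close> reads off the state of a deterministic finite automaton after a word, presented
  as a finite right-invariant colouring of words. The series is the generating function of the
  words with state in \<open>F\<close>, where the variable \<open>x_i\<close> marks the counter \<open>L i\<close>.
\<close>

lemma finite_state_counters_diagonal:
  fixes \<kappa> :: "'a list \<Rightarrow> 's" and L :: "nat \<Rightarrow> 'a list \<Rightarrow> nat"
  assumes X: "finite X" and fin: "finite (\<kappa> ` lists X)" and p: "p \<ge> 1"
    and state: "\<And>w w' x. w \<in> lists X \<Longrightarrow> w' \<in> lists X \<Longrightarrow> x \<in> X \<Longrightarrow> \<kappa> w = \<kappa> w' \<Longrightarrow>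
      \<kappa> (w @ [x]) = \<kappa> (w' @ [x])"
    and mono: "\<And>i w x. w \<in> lists X \<Longrightarrow> x \<in> X \<Longrightarrow> L i w \<le> L i (w @ [x])"
    and incr: "\<And>i w w' x. w \<in> lists X \<Longrightarrow> w' \<in> lists X \<Longrightarrow> x \<in> X \<Longrightarrow> \<kappa> w = \<kappa> w' \<Longrightarrow>
      L i (w @ [x]) - L i w = L i (w' @ [x]) - L i w'"
    and Nil: "\<And>i. L i [] = 0" and len: "\<And>w. L 0 w = length w"
  shows "\<exists>r\<in>nat_rational p. mps_diagonal p r =
    Abs_fps (\<lambda>k. card {w \<in> lists X. \<kappa> w \<in> F \<and> (\<forall>i<p. L i w = k)})"
proof -

  \<comment> \<open>Counter increments as exponent vectors\<close>
  define vec :: "(nat \<Rightarrow> nat) \<Rightarrow> nat \<Rightarrow>\<^sub>0 nat" where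
    "vec e = (\<Sum>i<p. Poly_Mapping.single i (e i))" for e
  have lookup_vec: "Poly_Mapping.lookup (vec e) j = (if j < p then e j else 0)" for e j
    by (simp add: vec_def lookup_sum lookup_single when_def)
  have vec_eq_iff: "vec e = vec e' \<longleftrightarrow> (\<forall>i<p. e i = e' i)" for e e'
    by (auto simp: poly_mapping_eq_iff fun_eq_iff lookup_vec)
  \<comment> \<open>The exponent vector contributed by reading \<open>v\<close> after
    \<open>w\<close>; by \<open>L_mono\<close> the subtraction is never truncated on words over
    \<open>X\<close>.\<close>
  define \<Delta> where "\<Delta> w v = vec (\<lambda>i. L i (w @ v) - L i w)" for w v
  have L_mono: "L i w \<le> L i (w @ v)" if "w \<in> lists X" "v \<in> lists X" for i w v
    using that(2,1)
  proof (induction v arbitrary: w)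
    case (Cons x v)
    have "L i w \<le> L i (w @ [x])"
      using mono Cons.prems Cons.hyps by simp
    also have "\<dots> \<le> L i ((w @ [x]) @ v)"
      using Cons.prems Cons.hyps by (intro Cons.IH) simp
    finally show ?case by simp
  qed simp
  have \<Delta>_Nil: "\<Delta> w [] = 0" for w
    by (simp add: \<Delta>_def vec_def)
  have \<Delta>_Cons: "\<Delta> w (x # v) = \<Delta> w [x] + \<Delta> (w @ [x]) v"
    if "w \<in> lists X" "x \<in> X" "v \<in> lists X" for w x v
  proof (rule poly_mapping_eqI)
    fix j
    have "L j w \<le> L j (w @ [x])" "L j (w @ [x]) \<le> L j (w @ x # v)"
      using L_mono[of w "[x]" j] L_mono[of "w @ [x]" v j] that by auto
    then show "Poly_Mapping.lookup (\<Delta> w (x # v)) j = Poly_Mapping.lookup (\<Delta> w [x] + \<Delta> (w @ [x]) v) j"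
      by (simp add: \<Delta>_def lookup_add lookup_vec)
  qed
  have \<Delta>_single: "\<Delta> w [x] = \<Delta> w' [x]"
    if "w \<in> lists X" "w' \<in> lists X" "x \<in> X" "\<kappa> w = \<kappa> w'" for w w' x
    using incr[OF that] by (simp add: \<Delta>_def vec_eq_iff)
  have cong: "\<kappa> (w @ v) = \<kappa> (w' @ v) \<and> \<Delta> w v = \<Delta> w' v"
    if "v \<in> lists X" "w \<in> lists X" "w' \<in> lists X" "\<kappa> w = \<kappa> w'" for v w w'
    using that
  proof (induction v arbitrary: w w')
    case (Cons x v)
    have "\<kappa> ((w @ [x]) @ v) = \<kappa> ((w' @ [x]) @ v) \<and> \<Delta> (w @ [x]) v = \<Delta> (w' @ [x]) v"
      using Cons.prems Cons.hyps state[of w w' x] by (intro Cons.IH) auto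
    moreover have "\<Delta> w [x] = \<Delta> w' [x]"
      using Cons.prems Cons.hyps by (intro \<Delta>_single) auto
    ultimately show ?case
      using Cons.prems Cons.hyps \<Delta>_Cons[of w x v] \<Delta>_Cons[of w' x v] by simp
  qed (simp add: \<Delta>_Nil)

  \<comment> \<open>Generating functions of the accepted continuations of a word\<close>
  define W where "W w m = {v \<in> lists X. \<kappa> (w @ v) \<in> F \<and> \<Delta> w v = m}" for w m
  define g where "g w m = card (W w m)" for w m
  have finW: "finite (W w m)" for w m
  proof (rule finite_subset)
    \<comment> \<open>Counter 0 records the length, so a fixed exponent vector leaves finitely many
      words.\<close>
    have "length v = Poly_Mapping.lookup m 0" if "\<Delta> w v = m" for v
      using p that by (auto simp: \<Delta>_def lookup_vec len)
    then show "W w m \<subseteq> {v. set v \<subseteq> X \<and> length v \<le> Poly_Mapping.lookup m 0}"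
      by (auto simp: W_def)
  qed (rule finite_lists_length_le[OF X])
  have g_cong: "g w = g w'" if "w \<in> lists X" "w' \<in> lists X" "\<kappa> w = \<kappa> w'" for w w'
  proof -
    have "W w m = W w' m" for m
      unfolding W_def using cong[OF _ that] by metis
    then show ?thesis by (auto simp: g_def)
  qed
  define mon :: "(nat \<Rightarrow>\<^sub>0 nat) \<Rightarrow> nat mps" where "mon u m = (if m = u then 1 else 0)" for u m
  have g_eq: "g w m = (if \<kappa> w \<in> F \<and> m = 0 then 1 else 0) +
      (\<Sum>x\<in>X. mps_mult (mon (\<Delta> w [x])) (g (w @ [x])) m)" if w: "w \<in> lists X" for w m
  proof -
    \<comment> \<open>For a letter \<open>x\<close>, these are the tails of the words in
      \<open>W w m\<close> that begin with \<open>x\<close>; splitting off the first letter makes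
      the equation linear.\<close>
    define V where "V x = (\<Union>b\<in>{b. \<Delta> w [x] + b = m}. W (w @ [x]) b)" for x
    have fin_b: "finite {b. u + b = m}" for u
      by (rule finite_subset[OF _ finite_imageI[OF finite_add_decompositions[of m], of snd]]) force
    have card_V: "card (V x) = mps_mult (mon (\<Delta> w [x])) (g (w @ [x])) m" for x
    proof -
      have "card (V x) = (\<Sum>b | \<Delta> w [x] + b = m. g (w @ [x]) b)"
        unfolding V_def g_def using finW fin_b
        by (intro card_UN_disjoint) (simp_all, auto simp: W_def)
      then show ?thesis
        by (simp add: mon_def[abs_def] mps_mult_monomial)
    qed
    have fin_V: "finite (V x)" for x
      unfolding V_def using finW fin_b by auto
    have W_eq: "W w m = (if \<kappa> w \<in> F \<and> m = 0 then {[]} else {}) \<union> (\<Union>x\<in>X. Cons x ` V x)" (is "_ = ?B")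
    proof (rule Set.set_eqI)
      fix v show "v \<in> W w m \<longleftrightarrow> v \<in> ?B"
      proof (cases v)
        case (Cons x u)
        have "u \<in> V x \<longleftrightarrow> u \<in> lists X \<and> \<kappa> (w @ x # u) \<in> F \<and> \<Delta> w [x] + \<Delta> (w @ [x]) u = m"
          by (auto simp: V_def W_def)
        then have "x # u \<in> W w m \<longleftrightarrow> x \<in> X \<and> u \<in> V x"
          using \<Delta>_Cons[OF w, of x u] by (cases "x \<in> X"; cases "u \<in> lists X") (simp_all add: W_def)
        also have "\<dots> \<longleftrightarrow> x # u \<in> ?B"
          by auto
        finally show ?thesis
          unfolding Cons .
      qed (auto simp: W_def \<Delta>_Nil)
    qed
    have "g w m = card (if \<kappa> w \<in> F \<and> m = 0 then {[] :: 'a list} else {}) + card (\<Union>x\<in>X. Cons x ` V x)"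
      unfolding g_def W_eq using X fin_V by (intro card_Un_disjoint) auto
    also have "card (\<Union>x\<in>X. Cons x ` V x) = (\<Sum>x\<in>X. card (Cons x ` V x))"
      using X fin_V by (intro card_UN_disjoint) auto
    finally show ?thesis
      by (simp add: card_image card_V)
  qed

  \<comment> \<open>The linear system indexed by the states\<close>
  define S where "S = \<kappa> ` lists X"
  \<comment> \<open>One word is chosen for each state; by \<open>g_cong\<close> its series does not
    depend on the choice.\<close>
  define rep where "rep = inv_into (lists X) \<kappa>"
  have rep: "rep s \<in> lists X" "\<kappa> (rep s) = s" if "s \<in> S" for s
    using that by (auto simp: rep_def S_def inv_into_into f_inv_into_f)
  define f where "f s = g (rep s)" for s
  have f: "f (\<kappa> w) = g w" if "w \<in> lists X" for w
    using that rep[of "\<kappa> w"] by (auto simp: f_def S_def intro: g_cong)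
  define a where "a s t = (\<lambda>m. \<Sum>x\<in>{x \<in> X. \<kappa> (rep s @ [x]) = t}. mon (\<Delta> (rep s) [x]) m)" for s t
  define c where "c s = (\<lambda>m. if s \<in> F \<and> m = (0 :: nat \<Rightarrow>\<^sub>0 nat) then 1 else 0 :: nat)" for s
  have f_rat: "f s \<in> nat_rational p" if "s \<in> S" for s
  proof (rule nat_rational_linear_system[where a = a and c = c and S = S])
    have keys: "Poly_Mapping.keys (\<Delta> w v) \<subseteq> {..<p}" for w v
      by (auto simp: \<Delta>_def in_keys_iff lookup_vec split: if_splits)
    show "a s t \<in> nat_rational p" for s t
      unfolding a_def mon_def using keys by (intro nat_rational_sum nat_rational_monomial)
    \<comment> \<open>Each letter raises the length counter by 1, so no transition has a constant
      monomial.\<close>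
    have "\<Delta> w [x] \<noteq> 0" for w x
    proof
      assume "\<Delta> w [x] = 0"
      then have "Poly_Mapping.lookup (\<Delta> w [x]) 0 = 0" by simp
      then show False using p by (simp add: \<Delta>_def lookup_vec len)
    qed
    then show "a s t 0 = 0" for s t
      by (auto simp: a_def mon_def)
    show "c s \<in> nat_rational p" for s
      using nat_rational_monomial[of 0 p] nat_rational_zero by (cases "s \<in> F") (simp_all add: c_def)
    show "f s = mps_add (c s) (\<lambda>m. \<Sum>t\<in>S. mps_mult (a s t) (f t) m)" if s: "s \<in> S" for s
    proof
      fix m
      have img: "(\<lambda>x. \<kappa> (rep s @ [x])) ` X \<subseteq> S"
        unfolding S_def using rep(1)[OF s] by (auto intro!: imageI)
      have "(\<Sum>t\<in>S. mps_mult (a s t) (f t) m) =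
          (\<Sum>t\<in>S. \<Sum>x\<in>{x \<in> X. \<kappa> (rep s @ [x]) = t}. mps_mult (mon (\<Delta> (rep s) [x])) (f t) m)"
        by (simp add: a_def mps_mult_sum_left)
      also have "\<dots> = (\<Sum>t\<in>S. \<Sum>x\<in>{x \<in> X. \<kappa> (rep s @ [x]) = t}.
          mps_mult (mon (\<Delta> (rep s) [x])) (g (rep s @ [x])) m)"
        using rep(1)[OF s] by (intro sum.cong) (auto simp: f[symmetric])
      also have "\<dots> = (\<Sum>x\<in>X. mps_mult (mon (\<Delta> (rep s) [x])) (g (rep s @ [x])) m)"
        using X fin img unfolding S_def by (intro sum.group)
      finally show "f s m = mps_add (c s) (\<lambda>m. \<Sum>t\<in>S. mps_mult (a s t) (f t) m) m"
        using g_eq[OF rep(1)[OF s], of m] rep(2)[OF s] by (simp add: f_def mps_add_def c_def)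
    qed
  qed (use fin that in \<open>auto simp: S_def\<close>)
  have "mps_diagonal p (g []) = Abs_fps (\<lambda>k. card {w \<in> lists X. \<kappa> w \<in> F \<and> (\<forall>i<p. L i w = k)})"
  proof -
    \<comment> \<open>From the empty word, the increments are the counters themselves.\<close>
    have "\<Delta> [] v = (\<Sum>i<p. Poly_Mapping.single i k) \<longleftrightarrow> (\<forall>i<p. L i v = k)" for v k
      using vec_eq_iff[of "\<lambda>i. L i v" "\<lambda>i. k"] by (simp add: \<Delta>_def Nil) (simp add: vec_def)
    then show ?thesis
      by (simp add: mps_diagonal_def g_def W_def)
  qed
  moreover have "g [] \<in> nat_rational p"
    using f[of "[]"] f_rat[of "\<kappa> []"] by (simp add: S_def)
  ultimately show ?thesis by blast
qed


section \<open>Relation lattices\<close>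

text \<open>
  The equations define the saturation of \<open>K\<close> in \<open>\<int>\<^sup>E\<close>, that is, the vectors with a nonzero
  multiple in \<open>K\<close>; the index of \<open>K\<close> in it is finite, and its exponent divides \<open>m\<close>.
\<close>

lemma subgroup_linear_equations:
  fixes K :: "('e \<Rightarrow> int) set"
  assumes "finite E"
    and "\<And>v e. v \<in> K \<Longrightarrow> e \<notin> E \<Longrightarrow> v e = 0"
    and "(\<lambda>e. 0) \<in> K"
    and "\<And>u v. u \<in> K \<Longrightarrow> v \<in> K \<Longrightarrow> (\<lambda>e. u e - v e) \<in> K"
  shows "\<exists>m>0. \<exists>d A. (\<forall>v\<in>K. \<forall>i<(d::nat). (\<Sum>e\<in>E. A i e * v e) = 0) \<and>
    (\<forall>v. (\<forall>e. e \<notin> E \<longrightarrow> v e = 0) \<longrightarrow> (\<forall>e. m dvd v e) \<longrightarrow>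
      (\<forall>i<d. (\<Sum>e\<in>E. A i e * v e) = 0) \<longrightarrow> v \<in> (K :: ('e \<Rightarrow> int) set))"
  using assms
proof (induction E arbitrary: K rule: finite_induct)
  case empty
  have "v \<in> K" if "\<forall>e. v e = 0" for v
    using empty(2) that by (metis ext)
  then show ?case
    by (intro exI[of _ "1::int"] conjI exI[of _ "0::nat"]) auto
next
  case (insert a E)
  note supp_K = insert.prems(1) and zero = insert.prems(2) and diff = insert.prems(3)
  have minus: "(\<lambda>e. - v e) \<in> K" if "v \<in> K" for v
    using diff[OF zero that] by simp
  have add: "(\<lambda>e. u e + v e) \<in> K" if "u \<in> K" "v \<in> K" for u v
    using diff[OF that(1) minus[OF that(2)]] by simp
  have scale: "(\<lambda>e. c * v e) \<in> K" if "v \<in> K" for c v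
  proof (induction c rule: int_induct[where k = 0])
    case (step1 i)
    then show ?case using add[of "\<lambda>e. i * v e" v] that by (simp add: algebra_simps)
  next
    case (step2 i)
    then show ?case using diff[of "\<lambda>e. i * v e" v] that by (simp add: algebra_simps)
  qed (simp add: zero)
  \<comment> \<open>The slice at \<open>a\<close> is a subgroup supported on \<open>E\<close>, to
    which the induction hypothesis applies.\<close>
  define K' where "K' = {v \<in> K. v a = 0}"
  have "\<exists>m>0. \<exists>d A. (\<forall>v\<in>K'. \<forall>i<(d::nat). (\<Sum>e\<in>E. A i e * v e) = 0) \<and>
    (\<forall>v. (\<forall>e. e \<notin> E \<longrightarrow> v e = 0) \<longrightarrow> (\<forall>e. m dvd v e) \<longrightarrow>
      (\<forall>i<d. (\<Sum>e\<in>E. A i e * v e) = 0) \<longrightarrow> v \<in> K')"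
  proof (rule insert.IH)
    show "v e = 0" if "v \<in> K'" "e \<notin> E" for v e
      using supp_K[of v e] that by (cases "e = a") (auto simp: K'_def)
  qed (auto simp: K'_def zero diff)
  then obtain m d A where m: "m > 0"
    and A1: "\<forall>v\<in>K'. \<forall>i<(d::nat). (\<Sum>e\<in>E. A i e * v e) = 0"
    and A2: "\<forall>v. (\<forall>e. e \<notin> E \<longrightarrow> v e = 0) \<longrightarrow> (\<forall>e. m dvd v e) \<longrightarrow>
      (\<forall>i<d. (\<Sum>e\<in>E. A i e * v e) = 0) \<longrightarrow> v \<in> K'"
    by blast
  show ?case
  proof (cases "\<forall>v\<in>K. v a = 0")
    case True
    \<comment> \<open>The old equations get coefficient 0 at \<open>a\<close>; the one of index
      \<open>d\<close> is the new equation \<open>v a = 0\<close>.\<close>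
    define B where "B i e = (if i < d then if e = a then 0 else A i e else if e = a then 1 else 0)"
      for i e
    have sum_B: "(\<Sum>e\<in>insert a E. B i e * v e) = (if i < d then \<Sum>e\<in>E. A i e * v e else v a)" for i v
    proof -
      have "(\<Sum>e\<in>insert a E. B i e * v e) = B i a * v a + (\<Sum>e\<in>E. (if i < d then A i e else 0) * v e)"
        using insert.hyps by (auto simp: B_def intro!: sum.cong)
      then show ?thesis by (simp add: B_def)
    qed
    have "v \<in> K" if "\<forall>e. e \<notin> insert a E \<longrightarrow> v e = 0" "\<forall>e. m dvd v e"
      "\<forall>i<Suc d. (\<Sum>e\<in>insert a E. B i e * v e) = 0" for v
    proof -
      have va: "v a = 0" using that(3)[rule_format, of d] unfolding sum_B by simp
      have "v \<in> K'"
      proof (rule A2[rule_format])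
        show "v e = 0" if "e \<notin> E" for e
          using va that \<open>\<forall>e. e \<notin> insert a E \<longrightarrow> v e = 0\<close> by (cases "e = a") auto
        show "(\<Sum>e\<in>E. A i e * v e) = 0" if "i < d" for i
          using \<open>\<forall>i<Suc d. _ i\<close>[rule_format, of i] that unfolding sum_B by simp
      qed (use that in auto)
      then show ?thesis by (simp add: K'_def)
    qed
    moreover have "\<forall>v\<in>K. \<forall>i<Suc d. (\<Sum>e\<in>insert a E. B i e * v e) = 0"
      unfolding sum_B using A1 True by (auto simp: K'_def)
    ultimately show ?thesis using m by blast
  next
    case False
    then obtain k c where k: "k \<in> K" and c: "c = k a" "c > 0"
      using minus by (metis neg_0_less_iff_less not_less_iff_gr_or_eq)
    \<comment> \<open>\<open>B\<close> applied to \<open>v\<close> is \<open>A\<close> applied to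
      \<open>c * v - v a * k\<close>, whose entry at \<open>a\<close> vanishes because
      \<open>k a = c\<close>: elimination without fractions.\<close>
    define B where "B i e = (if e = a then - (\<Sum>e'\<in>E. A i e' * k e') else c * A i e)" for i e
    have sum_B: "(\<Sum>e\<in>insert a E. B i e * v e) = (\<Sum>e\<in>E. A i e * (c * v e - v a * k e))" for i v
    proof -
      have "(\<Sum>e\<in>insert a E. B i e * v e) = - (\<Sum>e\<in>E. A i e * k e) * v a + (\<Sum>e\<in>E. c * A i e * v e)"
        using insert.hyps by (auto simp: B_def intro!: sum.cong)
      then show ?thesis
        by (simp add: algebra_simps sum_subtractf sum_distrib_left)
    qed
    have "v \<in> K" if supp: "\<forall>e. e \<notin> insert a E \<longrightarrow> v e = 0" and dv: "\<forall>e. c * m dvd v e"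
      and eq: "\<forall>i<d. (\<Sum>e\<in>insert a E. B i e * v e) = 0" for v
    proof -
      \<comment> \<open>The modulus \<open>c * m\<close> pays for the scaling: with
        \<open>v = c * u\<close>, the entries of \<open>c * u - u a * k\<close> are still divisible
        by \<open>m\<close>, so \<open>A2\<close> applies, and adding \<open>u a * k\<close> gives
        back \<open>v\<close>.\<close>
      define u where "u e = v e div c" for e
      have cv: "v e = c * u e" for e
        using dv by (metis dvd_mult_left dvd_mult_div_cancel u_def)
      have mu: "m dvd u e" for e
        using dv[rule_format, of e] c by (simp add: cv)
      have "(\<lambda>e. c * u e - u a * k e) \<in> K'"
      proof (rule A2[rule_format])
        show "c * u e - u a * k e = 0" if "e \<notin> E" for e
          using c supp_K[OF k, of e] supp[rule_format, of e] that by (cases "e = a") (auto simp: cv)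
        show "m dvd c * u e - u a * k e" for e
          using mu by simp
        fix i assume "i < d"
        then have "0 = (\<Sum>e\<in>E. A i e * (c * v e - v a * k e))"
          using eq sum_B by simp
        also have "\<dots> = c * (\<Sum>e\<in>E. A i e * (c * u e - u a * k e))"
          by (simp add: cv sum_distrib_left algebra_simps)
        finally show "(\<Sum>e\<in>E. A i e * (c * u e - u a * k e)) = 0"
          using c by simp
      qed
      then have "(\<lambda>e. c * u e - u a * k e) \<in> K"
        by (simp add: K'_def)
      from add[OF this scale[OF k, of "u a"]] show ?thesis
        by (simp flip: cv)
    qed
    moreover have "\<forall>v\<in>K. \<forall>i<d. (\<Sum>e\<in>insert a E. B i e * v e) = 0"
      unfolding sum_B
    proof (intro ballI allI impI)
      fix v i assume v: "v \<in> K" and i: "i < d"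
      have "(\<lambda>e. c * v e - v a * k e) \<in> K'"
        using diff[OF scale[OF v, of c] scale[OF k, of "v a"]] c by (simp add: K'_def)
      from A1[rule_format, OF this i] show "(\<Sum>e\<in>E. A i e * (c * v e - v a * k e)) = 0" .
    qed
    moreover have "c * m > 0" using c m by simp
    ultimately show ?thesis by blast
  qed
qed

section \<open>Words over a virtually abelian group\<close>

context group
begin

lemma word_value_closed: "w \<in> lists (carrier G) \<Longrightarrow> word_value G w \<in> carrier G"
  by (induction w) (auto simp: word_value_def)

lemma word_value_snoc:
  assumes "w \<in> lists (carrier G)" "x \<in> carrier G"
  shows "word_value G (w @ [x]) = word_value G w \<otimes> x"
  using assms(1)
proof (induction w)
  case (Cons y w)
  then show ?case
    using assms(2) word_value_closed[of w] by (simp add: word_value_def m_assoc)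
qed (simp add: word_value_def assms(2))

end

text \<open>An edge is a pair of a state \<open>c u\<close> and the letter read in it.\<close>

definition edge_count :: "('a list \<Rightarrow> 'c) \<Rightarrow> 'a list \<Rightarrow> 'c \<times> 'a \<Rightarrow> nat" where
  "edge_count c w e = card {i. i < length w \<and> (c (take i w), w ! i) = e}"

lemma edge_count_Nil: "edge_count c [] e = 0"
  by (simp add: edge_count_def)

lemma edge_count_snoc:
  "edge_count c (w @ [x]) e = edge_count c w e + (if e = (c w, x) then 1 else 0)"
proof -
  have "{i. i < length (w @ [x]) \<and> (c (take i (w @ [x])), (w @ [x]) ! i) = e} =
      {i. i < length w \<and> (c (take i w), w ! i) = e} \<union> (if e = (c w, x) then {length w} else {})"
    by (auto simp: nth_append less_Suc_eq split: if_splits)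
  then show ?thesis
    by (simp add: edge_count_def)
qed

lemma sum_edge_count_snoc:
  assumes "finite E" "(c w, x) \<in> E"
  shows "(\<Sum>e\<in>E. a e * edge_count c (w @ [x]) e) = (\<Sum>e\<in>E. a e * edge_count c w e) + a (c w, x)"
proof -
  have "(\<Sum>e\<in>E. a e * (if e = (c w, x) then 1 else 0)) = (\<Sum>e\<in>E. if e = (c w, x) then a e else 0)"
    by (rule sum.cong) auto
  then show ?thesis
    using assms by (simp add: edge_count_snoc algebra_simps sum.distrib)
qed

text \<open>Adding \<open>c\<close> raises the quotient by \<open>(a mod n + c) div n\<close>, which
  depends on \<open>a\<close> only through its remainder; so a finite state can determine the
  carry.\<close>

lemma div_add_diff_cong:
  fixes a b c n :: nat
  assumes "a mod n = b mod n"
  shows "(a + c) div n - a div n = (b + c) div n - b div n"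
proof -
  have "(a + c) div n = a div n + (a mod n + c) div n" for a
  proof (cases "n = 0")
    case False
    have "(a + c) div n = (a mod n + c + a div n * n) div n"
      by (metis add.assoc add.commute mod_div_mult_eq)
    also have "\<dots> = a div n + (a mod n + c) div n"
      using False by (rule div_mult_self1)
    finally show ?thesis .
  qed simp
  then show ?thesis using assms by (metis add_diff_cancel_left')
qed

lemma (in group) virtually_abelian_cogrowth_series_diagonal:
  assumes "virtually_abelian G" "finite X" "X \<subseteq> carrier G" "regular_language X R"
  shows "\<exists>p\<ge>1. \<exists>r\<in>nat_rational p. cogrowth_series G R = mps_diagonal p r"
proof -
  obtain H where H: "subgroup H G" and comm: "comm_group (G\<lparr>carrier := H\<rparr>)"
    and fin_cosets: "finite (rcosets H)"
    using assms(1) by (auto simp: virtually_abelian_def)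
  interpret H: comm_group "G\<lparr>carrier := H\<rparr>" by (rule comm)
  have H_sub: "H \<subseteq> carrier G"
    using H by (rule subgroup.subset)
  note X = assms(2,3)
  obtain Q :: "nat set" and q0 F \<delta> where Q: "finite Q" "q0 \<in> Q"
    and \<delta>: "\<And>q x. q \<in> Q \<Longrightarrow> x \<in> X \<Longrightarrow> \<delta> q x \<in> Q"
    and R: "R = {w \<in> lists X. foldl \<delta> q0 w \<in> F}"
    using assms(4) unfolding regular_language_def by metis

  define coset where "coset w = H #> word_value G w" for w
  have val: "word_value G w \<in> carrier G" if "w \<in> lists X" for w
    using that X by (intro word_value_closed) auto
  have val_snoc: "word_value G (w @ [x]) = word_value G w \<otimes> x" if "w \<in> lists X" "x \<in> X" for w x
    using that X by (intro word_value_snoc) auto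
  have coset: "coset w \<in> rcosets H" if "w \<in> lists X" for w
    unfolding coset_def using H_sub val[OF that] by (rule rcosetsI)
  have coset_snoc: "coset (w @ [x]) = coset w #> x" if "w \<in> lists X" "x \<in> X" for w x
  proof -
    have "x \<in> carrier G" using that X by auto
    then show ?thesis
      using that coset_mult_assoc[OF H_sub val] by (simp add: coset_def val_snoc)
  qed
  have coset_Nil: "coset [] = H"
    using H_sub by (simp add: coset_def word_value_def)

  \<comment> \<open>Coset representatives and Schreier elements\<close>
  define t where "t C = (SOME g. g \<in> C)" for C :: "'a set"
  have t: "t C \<in> carrier G" "H #> t C = C" if C: "C \<in> rcosets H" for C
  proof -
    obtain g where g: "g \<in> carrier G" "C = H #> g"
      using C by (auto simp: RCOSETS_def)
    then have "g \<in> C"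
      using rcos_self[OF _ H] by simp
    then have "t C \<in> C"
      unfolding t_def by (rule someI)
    then show "t C \<in> carrier G" "H #> t C = C"
      using g H H_sub repr_independence r_coset_subset_G by (metis subsetD)+
  qed
  \<comment> \<open>Schreier generators: \<open>fst e #> snd e\<close> is the coset reached from
    \<open>fst e\<close> by the letter \<open>snd e\<close>.\<close>
  define h where "h e = t (fst e) \<otimes> snd e \<otimes> inv t (fst e #> snd e)" for e
  define E where "E = (rcosets H) \<times> X"
  have finE: "finite E"
    using fin_cosets X by (simp add: E_def)
  have step_coset: "C #> x \<in> rcosets H" "C #> x = H #> (t C \<otimes> x)" if "C \<in> rcosets H" "x \<in> X" for C x
  proof -
    show "C #> x = H #> (t C \<otimes> x)"
      using t[OF that(1)] that X H_sub by (metis coset_mult_assoc subsetD)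
    have "t C \<otimes> x \<in> carrier G"
      using t[OF that(1)] that X by auto
    then show "C #> x \<in> rcosets H"
      unfolding \<open>C #> x = _\<close> using H_sub by (intro rcosetsI)
  qed
  have h_H: "h e \<in> H" if e_E: "e \<in> E" for e
  proof -
    obtain C x where e: "e = (C, x)" "C \<in> rcosets H" "x \<in> X"
      using e_E by (auto simp: E_def)
    then have x: "x \<in> carrier G" using X by auto
    have "t C \<otimes> x \<in> H #> t (C #> x)"
      using step_coset[OF e(2,3)] t e x rcos_self[OF _ H] by simp
    then obtain k where k: "k \<in> H" "t C \<otimes> x = k \<otimes> t (C #> x)"
      by (auto simp: r_coset_def)
    have "k \<otimes> t (C #> x) \<otimes> inv t (C #> x) = k"
      using k(1) H_sub t(1)[OF step_coset(1)[OF e(2,3)]] by (simp add: m_assoc subset_iff)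
    then show ?thesis
      using k e(1) by (simp add: h_def)
  qed

  \<comment> \<open>The homomorphism from integer vectors to the abelian subgroup\<close>
  define \<Phi> :: "('a set \<times> 'a \<Rightarrow> int) \<Rightarrow> 'a" where
    "\<Phi> v = finprod (G\<lparr>carrier := H\<rparr>) (\<lambda>e. h e [^]\<^bsub>G\<lparr>carrier := H\<rparr>\<^esub> (v e :: int)) E" for v
  have pow_H: "h e [^]\<^bsub>G\<lparr>carrier := H\<rparr>\<^esub> (k :: int) \<in> H" if "e \<in> E" for e k
    using H.int_pow_closed[of "h e" k] h_H[OF that] by simp
  have \<Phi>_H: "\<Phi> v \<in> H" for v
    unfolding \<Phi>_def using H.finprod_closed[of _ E] pow_H by (simp add: Pi_def)
  have \<Phi>_add: "\<Phi> (\<lambda>e. u e + v e) = \<Phi> u \<otimes> \<Phi> v" for u v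
  proof -
    have "\<Phi> (\<lambda>e. u e + v e) = finprod (G\<lparr>carrier := H\<rparr>)
        (\<lambda>e. h e [^]\<^bsub>G\<lparr>carrier := H\<rparr>\<^esub> u e \<otimes>\<^bsub>G\<lparr>carrier := H\<rparr>\<^esub> h e [^]\<^bsub>G\<lparr>carrier := H\<rparr>\<^esub> v e) E"
      unfolding \<Phi>_def using h_H pow_H H.int_pow_mult subgroup.m_closed[OF H]
      by (intro H.finprod_cong') (auto simp: Pi_def)
    \<comment> \<open>Commutativity of \<open>H\<close> allows the factors to be regrouped.\<close>
    also have "\<dots> = \<Phi> u \<otimes>\<^bsub>G\<lparr>carrier := H\<rparr>\<^esub> \<Phi> v"
      unfolding \<Phi>_def using pow_H by (intro H.finprod_multf) auto
    finally show ?thesis by simp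
  qed
  have \<Phi>_single: "\<Phi> (\<lambda>e. if e = e0 then 1 else 0) = h e0" if "e0 \<in> E" for e0
  proof -
    have "\<Phi> (\<lambda>e. if e = e0 then 1 else 0) =
        finprod (G\<lparr>carrier := H\<rparr>) (\<lambda>e. if e0 = e then h e else \<one>\<^bsub>G\<lparr>carrier := H\<rparr>\<^esub>) E"
      unfolding \<Phi>_def
    proof (rule H.finprod_cong'[OF refl])
      show "h e [^]\<^bsub>G\<lparr>carrier := H\<rparr>\<^esub> (if e = e0 then 1 else 0 :: int) =
          (if e0 = e then h e else \<one>\<^bsub>G\<lparr>carrier := H\<rparr>\<^esub>)" if "e \<in> E" for e
        using H.int_pow_1[of "h e"] h_H[OF that] by (cases "e = e0") simp_all
    qed (use h_H subgroup.one_closed[OF H] in \<open>simp add: Pi_def\<close>)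
    also have "\<dots> = h e0"
      using that finE h_H by (intro H.finprod_singleton) auto
    finally show ?thesis .
  qed
  have \<Phi>_zero: "\<Phi> (\<lambda>e. 0) = \<one>"
    using H.finprod_one[of E] by (simp add: \<Phi>_def)

  \<comment> \<open>Edge counts and the words of value 1\<close>
  define n where "n = edge_count coset"
  have n_Nil: "n [] e = 0" for e
    by (simp add: n_def edge_count_Nil)
  have n_snoc: "n (w @ [x]) e = n w e + (if e = (coset w, x) then 1 else 0)" for w x e
    by (simp add: n_def edge_count_snoc)
  have edge: "(coset w, x) \<in> E" if "w \<in> lists X" "x \<in> X" for w x
    using that coset by (simp add: E_def)
  have n_supp: "n w e = 0" if "w \<in> lists X" "e \<notin> E" for w e
    using that(1)
  proof (induction w rule: rev_induct)
    case (snoc x w)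
    then show ?case
      using edge[of w x] that(2) by (auto simp: n_snoc)
  qed (simp add: n_Nil)
  \<comment> \<open>Taken along the word, the product telescopes: the inner representatives cancel
    and only the first and the last survive.\<close>
  have \<Phi>_n: "\<Phi> (\<lambda>e. int (n w e)) = t H \<otimes> word_value G w \<otimes> inv t (coset w)"
    if "w \<in> lists X" for w
    using that
  proof (induction w rule: rev_induct)
    case Nil
    have "H \<in> rcosets H" using coset[of "[]"] coset_Nil by simp
    then show ?case
      using t by (simp add: n_Nil \<Phi>_zero coset_Nil word_value_def)
  next
    case (snoc x w)
    then have w: "w \<in> lists X" and x: "x \<in> X" "x \<in> carrier G" using X by auto
    have tH: "t H \<in> carrier G"
      using t coset[of "[]"] coset_Nil by simp
    have cancel: "inv t (coset w) \<otimes> (t (coset w) \<otimes> y) = y" if "y \<in> carrier G" for y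
      using that t(1)[OF coset[OF w]] by (simp flip: m_assoc)
    have "\<Phi> (\<lambda>e. int (n (w @ [x]) e)) = \<Phi> (\<lambda>e. int (n w e) + (if e = (coset w, x) then 1 else 0))"
      by (rule arg_cong[where f = \<Phi>]) (auto simp: n_snoc)
    also have "\<dots> = (t H \<otimes> word_value G w \<otimes> inv t (coset w)) \<otimes> h (coset w, x)"
      using snoc.IH w edge[OF w x(1)] by (simp add: \<Phi>_add \<Phi>_single)
    also have "\<dots> = t H \<otimes> (word_value G w \<otimes> x) \<otimes> inv t (coset w #> x)"
      using t(1)[OF coset[OF w]] t(1)[OF step_coset(1)[OF coset[OF w] x(1)]] tH val[OF w] x
      by (simp add: h_def m_assoc cancel)
    finally show ?case
      using w x by (simp add: val_snoc coset_snoc)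
  qed
  have val_one_iff: "word_value G w = \<one> \<longleftrightarrow> coset w = H \<and> \<Phi> (\<lambda>e. int (n w e)) = \<one>"
    if w: "w \<in> lists X" for w
  proof -
    have tH: "t H \<in> carrier G"
      using t coset[of "[]"] coset_Nil by simp
    have "word_value G w = \<one> \<Longrightarrow> coset w = H"
      using H_sub by (simp add: coset_def)
    \<comment> \<open>The representative \<open>t H\<close> may differ from \<open>\<one>\<close>,
      so for \<open>coset w = H\<close> the product is only a conjugate of the value; this suffices
      for testing triviality.\<close>
    moreover have "t H \<otimes> word_value G w \<otimes> inv t H = \<one> \<longleftrightarrow> word_value G w = \<one>"
      using tH val[OF w] by (metis inv_closed inv_comm l_cancel_one' m_closed r_inv inv_equality inv_inv)
    ultimately show ?thesis
      using \<Phi>_n[OF w] by auto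
  qed

  \<comment> \<open>The relation lattice and its equations\<close>
  define K where "K = {v. (\<forall>e. e \<notin> E \<longrightarrow> v e = 0) \<and> \<Phi> v = \<one>}"
  have "(\<lambda>e. u e - v e) \<in> K" if "u \<in> K" "v \<in> K" for u v
  proof -
    have "\<Phi> (\<lambda>e. u e - v e) \<otimes> \<Phi> v = \<Phi> u"
      using \<Phi>_add[of "\<lambda>e. u e - v e" v] by simp
    moreover have "\<Phi> (\<lambda>e. u e - v e) \<in> carrier G"
      using \<Phi>_H H_sub by blast
    ultimately have "\<Phi> (\<lambda>e. u e - v e) = \<one>"
      using that by (simp add: K_def)
    then show ?thesis
      using that by (simp add: K_def)
  qed
  then have "\<exists>m>0. \<exists>d A. (\<forall>v\<in>K. \<forall>i<(d::nat). (\<Sum>e\<in>E. A i e * v e) = 0) \<and>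
    (\<forall>v. (\<forall>e. e \<notin> E \<longrightarrow> v e = 0) \<longrightarrow> (\<forall>e. m dvd v e) \<longrightarrow>
      (\<forall>i<d. (\<Sum>e\<in>E. A i e * v e) = 0) \<longrightarrow> v \<in> K)"
    using finE by (intro subgroup_linear_equations) (auto simp: K_def \<Phi>_zero)
  then obtain m d A where m: "m > 0"
    and A1: "\<forall>v\<in>K. \<forall>i<(d::nat). (\<Sum>e\<in>E. A i e * v e) = 0"
    and A2: "\<forall>v. (\<forall>e. e \<notin> E \<longrightarrow> v e = 0) \<longrightarrow> (\<forall>e. m dvd v e) \<longrightarrow>
      (\<forall>i<d. (\<Sum>e\<in>E. A i e * v e) = 0) \<longrightarrow> v \<in> K"
    by blast

  \<comment> \<open>A multiple of \<open>m\<close>, so that congruence modulo \<open>N\<close> gives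
    the divisibility in \<open>A2\<close>, and a bound for all \<open>\<bar>A i e\<bar>\<close>; the
    summand 1 keeps it positive.\<close>
  define N where "N = nat (m * (1 + (\<Sum>i<d. \<Sum>e\<in>E. \<bar>A i e\<bar>)))"
  have N_int: "int N = m * (1 + (\<Sum>i<d. \<Sum>e\<in>E. \<bar>A i e\<bar>))"
    using m by (simp add: N_def sum_nonneg)
  then have m_dvd: "m dvd int N" by simp
  have N: "N > 0"
  proof -
    have "0 < 1 + (\<Sum>i<d. \<Sum>e\<in>E. \<bar>A i e\<bar>)"
      by (intro add_pos_nonneg sum_nonneg) auto
    then have "0 < int N" unfolding N_int using m by (rule mult_pos_pos[rotated])
    then show ?thesis by simp
  qed
  have A_le: "\<bar>A i e\<bar> \<le> int N" if "i < d" "e \<in> E" for i e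
  proof -
    have "\<bar>A i e\<bar> \<le> (\<Sum>e\<in>E. \<bar>A i e\<bar>)"
      using that finE by (intro member_le_sum) auto
    also have "\<dots> \<le> (\<Sum>i<d. \<Sum>e\<in>E. \<bar>A i e\<bar>)"
      using that by (intro member_le_sum[of i "{..<d}" "\<lambda>i. \<Sum>e\<in>E. \<bar>A i e\<bar>"]) (auto intro: sum_nonneg)
    also have "\<dots> \<le> 1 * (1 + (\<Sum>i<d. \<Sum>e\<in>E. \<bar>A i e\<bar>))" by simp
    also have "\<dots> \<le> int N"
      unfolding N_int using m by (intro mult_right_mono) (auto intro!: add_nonneg_nonneg sum_nonneg)
    finally show ?thesis .
  qed
  define a where "a i e = nat (A i e + int N)" for i e
  define D where "D i w = (\<Sum>e\<in>E. a i e * n w e)" for i w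
  have D_snoc: "D i (w @ [x]) = D i w + a i (coset w, x)" if "w \<in> lists X" "x \<in> X" for i w x
    unfolding D_def n_def using finE edge[OF that] by (rule sum_edge_count_snoc)
  have sum_n: "(\<Sum>e\<in>E. n w e) = length w" if "w \<in> lists X" for w
    using that
  proof (induction w rule: rev_induct)
    case (snoc x w)
    then show ?case
      using sum_edge_count_snoc[of E coset w x "\<lambda>_. 1"] finE edge[of w x] by (simp add: n_def)
  qed (simp add: n_Nil)
  \<comment> \<open>The counts add up to the length of \<open>w\<close>, so shifting every
    coefficient by \<open>N\<close> adds \<open>N\<close> times the length.\<close>
  have D: "int (D i w) = (\<Sum>e\<in>E. A i e * int (n w e)) + int N * int (length w)"
    if "i < d" "w \<in> lists X" for i w
  proof -
    have "int (D i w) = (\<Sum>e\<in>E. (A i e + int N) * int (n w e))"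
      unfolding D_def of_nat_sum
    proof (rule sum.cong[OF refl])
      fix e assume "e \<in> E"
      then have "int (a i e) = A i e + int N"
        using A_le[OF that(1), of e] by (simp add: a_def)
      then show "int (a i e * n w e) = (A i e + int N) * int (n w e)" by simp
    qed
    then show ?thesis
      by (simp add: sum_n[OF that(2), symmetric] algebra_simps sum.distrib sum_distrib_left)
  qed

  \<comment> \<open>The finite state and the counters\<close>
  define \<kappa> where "\<kappa> w = (foldl \<delta> q0 w, coset w, \<lambda>e. n w e mod N)" for w
  \<comment> \<open>Counter 0 is the length, and the equation of index \<open>i\<close> gets counter
    \<open>i + 1\<close>. The state fixes \<open>D i w mod N\<close>, hence the increments of the
    quotient.\<close>
  define L where "L i w = (case i of 0 \<Rightarrow> length w | Suc i \<Rightarrow> D i w div N)" for i w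
  have n_mod: "n w e mod N = n w' e mod N" if "\<kappa> w = \<kappa> w'" for w w' e
    using that fun_cong[of "\<lambda>e. n w e mod N" "\<lambda>e. n w' e mod N" e] by (simp add: \<kappa>_def)
  have D_mod: "D i w mod N = D i w' mod N" if "\<kappa> w = \<kappa> w'" for i w w'
  proof -
    have "(a i e * n w e) mod N = (a i e * n w' e) mod N" for e
      using n_mod[OF that, of e] by (metis mod_mult_right_eq)
    then have "(\<Sum>e\<in>E. (a i e * n w e) mod N) mod N = (\<Sum>e\<in>E. (a i e * n w' e) mod N) mod N"
      by simp
    then show ?thesis
      unfolding D_def mod_sum_eq .
  qed
  \<comment> \<open>A state is accepting if some word of \<open>R\<close> with value 1 reaches it;
    the counters then decide for the other words in that state.\<close>
  define F' where "F' = \<kappa> ` {w \<in> R. word_value G w = \<one>}"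
  have "\<exists>r\<in>nat_rational (Suc d). mps_diagonal (Suc d) r =
      Abs_fps (\<lambda>k. card {w \<in> lists X. \<kappa> w \<in> F' \<and> (\<forall>i<Suc d. L i w = k)})"
  proof (rule finite_state_counters_diagonal)
    have state: "foldl \<delta> q0 w \<in> Q" if "w \<in> lists X" for w
      using that by (induction w rule: rev_induct) (auto simp: Q \<delta>)
    let ?f = "{f. \<forall>e. (e \<in> E \<longrightarrow> f e \<in> {..<N}) \<and> (e \<notin> E \<longrightarrow> f e = 0)}"
    have "finite (Q \<times> (rcosets H) \<times> ?f)"
      using Q fin_cosets finE by (intro finite_cartesian_product finite_set_of_finite_funs) auto
    moreover have "\<kappa> ` lists X \<subseteq> Q \<times> (rcosets H) \<times> ?f"
    proof (rule image_subsetI)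
      fix w assume w: "w \<in> lists X"
      then show "\<kappa> w \<in> Q \<times> (rcosets H) \<times> ?f"
        using state[OF w] coset[OF w] n_supp[OF w] N by (simp add: \<kappa>_def)
    qed
    ultimately show "finite (\<kappa> ` lists X)"
      by (rule finite_subset[rotated])
    fix w w' x assume w: "w \<in> lists X" "w' \<in> lists X" "x \<in> X" and eq: "\<kappa> w = \<kappa> w'"
    have "(n w e + k) mod N = (n w' e + k) mod N" for e k
      using n_mod[OF eq] by (metis mod_add_left_eq)
    then show "\<kappa> (w @ [x]) = \<kappa> (w' @ [x])"
      using w eq by (simp add: \<kappa>_def coset_snoc n_snoc)
    show "L i (w @ [x]) - L i w = L i (w' @ [x]) - L i w'" for i
      using w eq D_mod[OF eq] by (auto simp: L_def D_snoc \<kappa>_def intro!: div_add_diff_cong split: nat.split)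
  next
    show "L i w \<le> L i (w @ [x])" if "w \<in> lists X" "x \<in> X" for i w x
      using that by (auto simp: L_def D_snoc div_le_mono split: nat.split)
  qed (auto simp: X L_def D_def n_Nil split: nat.split)
  moreover have "{w \<in> lists X. \<kappa> w \<in> F' \<and> (\<forall>i<Suc d. L i w = k)} =
      {w \<in> R. length w = k \<and> word_value G w = \<one>}" for k
  proof (intro equalityI subsetI)
    have K: "(\<lambda>e. int (n w e)) \<in> K" if "w \<in> R" "word_value G w = \<one>" for w
      using that val_one_iff n_supp by (auto simp: K_def R)
    have D_R: "D i w = N * length w" if "w \<in> R" "word_value G w = \<one>" "i < d" for i w
    proof -
      have "int (D i w) = int (N * length w)"
        using D[of i w] A1[rule_format, OF K[OF that(1,2)] that(3)] that by (simp add: R)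
      then show ?thesis by linarith
    qed
    {
      fix w assume "w \<in> {w \<in> R. length w = k \<and> word_value G w = \<one>}"
      then show "w \<in> {w \<in> lists X. \<kappa> w \<in> F' \<and> (\<forall>i<Suc d. L i w = k)}"
        using D_R N by (auto simp: F'_def R L_def split: nat.split)
    next
      fix w assume "w \<in> {w \<in> lists X. \<kappa> w \<in> F' \<and> (\<forall>i<Suc d. L i w = k)}"
      then have w: "w \<in> lists X" and F': "\<kappa> w \<in> F'" and L: "\<And>i. i < Suc d \<Longrightarrow> L i w = k"
        by auto
      obtain w' where w': "w' \<in> R" "word_value G w' = \<one>" and eq: "\<kappa> w = \<kappa> w'"
        using F' by (auto simp: F'_def)
      have wR: "w \<in> R"
        using w w' eq by (auto simp: R \<kappa>_def)
      have len: "length w = k"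
        using L[of 0] by (simp add: L_def)
      \<comment> \<open>The remainder agrees with that for \<open>w'\<close>, which is 0, and the
        counters make the quotient equal to the length.\<close>
      have D_w: "D i w = N * length w" if "i < d" for i
      proof -
        have "D i w mod N = 0"
          using D_mod[OF eq] D_R[OF w' that] by simp
        moreover have "D i w div N = length w"
          using L[of "Suc i"] that len by (simp add: L_def)
        ultimately show ?thesis
          by (metis add_0_right mult_div_mod_eq)
      qed
      have A_w: "(\<Sum>e\<in>E. A i e * int (n w e)) = 0" if "i < d" for i
        using D[OF that w] D_w[OF that] by simp
      \<comment> \<open>Both count vectors solve the equations and agree modulo \<open>N\<close>, so
        their difference lies in \<open>K\<close> and \<open>\<Phi>\<close> has the same value at
        both. The lengths of \<open>w\<close> and \<open>w'\<close> may differ.\<close>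
      define v where "v e = int (n w e) - int (n w' e)" for e
      have "v \<in> K"
      proof (rule A2[rule_format])
        show "v e = 0" if "e \<notin> E" for e
          using n_supp[OF _ that] w w' by (simp add: v_def R)
        show "m dvd v e" for e
        proof -
          have "int (n w e) mod int N = int (n w' e) mod int N"
            using n_mod[OF eq] by (metis zmod_int)
          then have "int N dvd v e"
            unfolding v_def by (simp add: mod_eq_dvd_iff)
          then show ?thesis using m_dvd by (rule dvd_trans[rotated])
        qed
        show "(\<Sum>e\<in>E. A i e * v e) = 0" if "i < d" for i
          using A_w[OF that] A1[rule_format, OF K[OF w'] that]
          by (simp add: v_def right_diff_distrib sum_subtractf)
      qed
      moreover have "\<Phi> (\<lambda>e. int (n w e)) = \<Phi> v \<otimes> \<Phi> (\<lambda>e. int (n w' e))"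
        unfolding \<Phi>_add[symmetric] by (simp add: v_def)
      ultimately have "\<Phi> (\<lambda>e. int (n w e)) = \<one>"
        using K[OF w'] by (simp add: K_def)
      moreover have "coset w = H"
        using eq w' val_one_iff[of w'] by (simp add: \<kappa>_def R)
      ultimately show "w \<in> {w \<in> R. length w = k \<and> word_value G w = \<one>}"
        using val_one_iff[OF w] wR len by simp
    }
  qed
  ultimately obtain r where "r \<in> nat_rational (Suc d)"
    "mps_diagonal (Suc d) r = cogrowth_series G R"
    by (auto simp: cogrowth_series_def)
  then show ?thesis
    by (intro exI[of _ "Suc d"] conjI bexI[of _ r]) auto
qed

theorem theoremB:
  fixes G :: "('a, 'b) monoid_scheme" and X :: "'a set" and R :: "'a list set"
  assumes "group G"
    and "virtually_abelian G"
    and "finite_monoid_generating_set G X"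
    and "regular_language X R"
  shows "\<exists>p\<ge>1. \<exists>r\<in>nat_rational p. cogrowth_series G R = mps_diagonal p r"
proof (rule group.virtually_abelian_cogrowth_series_diagonal[OF assms(1,2) _ _ assms(4)])
  show "finite X" "X \<subseteq> carrier G"
    using assms(3) by (simp_all add: finite_monoid_generating_set_def)
qed

end
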